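(* For all $n\ge1$, $$d_{KS}(Y_n,Y)>\frac{1}{8(n+1)}.$$
   Context: Let $X_n$ be the number of comparisons used by randomized Quicksort (uniform random pivot) on $n$ distinct numbers. Equivalently, $X_0=0$ and $$X_n\stackrel{d}{=}X_{U_n-1}+X^*_{n-U_n}+n-1,$$ with $U_n$ uniform on $\{1,\dots,n\}$, $X_j^*\stackrel{d}{=}X_j$, all independent. Let $\mu_n=\mathbf EX_n=2(n+1)H_n-4n$, where $H_n=\sum_{k\le n}1/k$, and $Y_n=(X_n-\mu_n)/n$. $Y$ is the distributional limit of $Y_n$. Its law is the unique law with mean $0$ and finite variance satisfying $Y\stackrel{d}{=}UY+(1-U)Y^*+C(U)$, where $U\sim\mathrm{unif}(0,1)$, $Y^*\stackrel{d}{=}Y$, $U,Y,Y^*$ are independent, and $C(u)=2u\ln u+2(1-u)\ln(1-u)+1$. $Y$ has an absolutely continuous distribution. $d_{KS}(X,Y):=\sup_x|P(X\le x)-P(Y\le x)|$. *)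

theory Defs
  imports "HOL-Probability.Probability"
begin

text \<open>Laws of the Quicksort comparison counts X_0, ..., X_n (as a list of pmfs),
  built by the distributional recursion
  X_n = X_{U_n - 1} + X*_{n - U_n} + n - 1, U_n uniform on {1..n}.\<close>
fun qs_list :: "nat \<Rightarrow> nat pmf list" where
  "qs_list 0 = [return_pmf 0]"
| "qs_list (Suc n) =
     (let L = qs_list n in
        L @ [bind_pmf (pmf_of_set {1..Suc n}) (\<lambda>u.
               bind_pmf (L ! (u - 1)) (\<lambda>a.
                 map_pmf (\<lambda>b. a + b + n) (L ! (Suc n - u))))])"

definition qs :: "nat \<Rightarrow> nat pmf" where
  "qs n = qs_list n ! n"

definition qs_mean :: "nat \<Rightarrow> real" where
  "qs_mean n = 2 * (real n + 1) * (\<Sum>k=1..n. 1 / real k) - 4 * real n"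

definition Y_law :: "nat \<Rightarrow> real measure" where
  "Y_law n = distr (measure_pmf (qs n)) borel (\<lambda>x. (real x - qs_mean n) / real n)"

definition d_KS :: "real measure \<Rightarrow> real measure \<Rightarrow> real" where
  "d_KS M N = (SUP x::real. \<bar>cdf M x - cdf N x\<bar>)"

end

theory Submission
  imports Defs "HOL-Real_Asymp.Real_Asymp"
begin

text \<open>
  The limit law \<open>Y\<close> has no atoms, so a jump of size \<open>p\<close> of the distribution function of \<open>Y_n\<close>
  forces the Kolmogorov-Smirnov distance to be at least \<open>p / 2\<close>. Hence it suffices that
  \<open>X_n\<close> has an atom larger than \<open>1 / (4 (n + 1))\<close>. This holds because an integer-valued variable whose
  atoms are all at most \<open>p\<close> has variance at least \<open>(1 / p\<^sup>2 - 1) / 12\<close>, while the Quicksort recursion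
  gives \<open>Var X_n \<le> 7/6 (n + 1)\<^sup>2\<close> (the true constant is about 0.42).

  For the absence of atoms, the recursion for the characteristic functions passes to the limit and
  identifies \<open>Y\<close> with the law of \<open>U Y + (1 - U) Y* + C(U)\<close>. For fixed values of \<open>Y\<close> and \<open>Y*\<close> this is a
  strictly convex function of \<open>U\<close>, so it takes each value at most twice.
\<close>

section \<open>The Quicksort recursion\<close>

lemma length_qs_list: "length (qs_list n) = Suc n"
  by (induction n) (auto simp: Let_def)

lemma nth_qs_list: "i \<le> n \<Longrightarrow> qs_list n ! i = qs i"
proof (induction n)
  case (Suc n)
  show ?case
  proof (cases "i = Suc n")
    case False
    with Suc.prems have "i \<le> n" by simp
    then have "qs_list (Suc n) ! i = qs_list n ! i"
      by (simp add: Let_def nth_append length_qs_list)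
    with Suc.IH \<open>i \<le> n\<close> show ?thesis by simp
  qed (simp add: qs_def)
qed (simp add: qs_def)

lemma qs_0: "qs 0 = return_pmf 0"
  by (simp add: qs_def)

text \<open>Indexing by the size \<open>j = u - 1\<close> of the lower part instead of the pivot
  rank \<open>u\<close> gives the two parts the sizes \<open>j\<close> and
  \<open>n - j\<close>.\<close>

lemma qs_Suc:
  "qs (Suc n) = bind_pmf (pmf_of_set {..n}) (\<lambda>j.
     bind_pmf (qs j) (\<lambda>a. map_pmf (\<lambda>b. a + b + n) (qs (n - j))))"
proof -
  have "qs (Suc n) = bind_pmf (pmf_of_set {1..Suc n}) (\<lambda>u.
      bind_pmf (qs_list n ! (u - 1)) (\<lambda>a. map_pmf (\<lambda>b. a + b + n) (qs_list n ! (Suc n - u))))"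
    by (simp add: qs_def Let_def nth_append length_qs_list)
  also have "\<dots> = bind_pmf (pmf_of_set {1..Suc n}) (\<lambda>u.
      bind_pmf (qs (u - 1)) (\<lambda>a. map_pmf (\<lambda>b. a + b + n) (qs (Suc n - u))))"
    by (intro bind_pmf_cong refl) (auto simp: nth_qs_list)
  also have "pmf_of_set {1..Suc n} = map_pmf Suc (pmf_of_set {..n})"
    by (subst map_pmf_of_set_inj) (auto simp: image_Suc_atMost)
  finally show ?thesis
    by (simp add: bind_map_pmf)
qed

lemma finite_set_pmf_qs [simp]: "finite (set_pmf (qs n))"
proof (induction n rule: less_induct)
  case (less n)
  show ?case
    by (cases n) (auto simp: qs_0 qs_Suc less)
qed

lemma integrable_qs [simp, intro]:
  fixes h :: "nat \<Rightarrow> 'a::{banach, second_countable_topology}"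
  shows "integrable (measure_pmf (qs n)) h"
  by (simp add: integrable_measure_pmf_finite)

lemma expectation_qs_Suc:
  fixes h :: "nat \<Rightarrow> 'a::{banach, second_countable_topology}"
  shows "measure_pmf.expectation (qs (Suc n)) h = (\<Sum>j\<le>n.
     measure_pmf.expectation (qs j) (\<lambda>a. measure_pmf.expectation (qs (n - j)) (\<lambda>b. h (a + b + n))))
     /\<^sub>R (real n + 1)"
proof -
  have "measure_pmf.expectation (bind_pmf (qs j) (\<lambda>a. map_pmf (\<lambda>b. a + b + n) (qs (n - j)))) h
     = measure_pmf.expectation (qs j) (\<lambda>a. measure_pmf.expectation (qs (n - j)) (\<lambda>b. h (a + b + n)))"
    for j
    by (subst pmf_expectation_bind[where A = "set_pmf (qs j)"])
       (auto simp: integral_measure_pmf[where A = "set_pmf (qs j)"])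
  then show ?thesis
    unfolding qs_Suc
    by (subst pmf_expectation_bind_pmf_of_set) (auto simp: scaleR_sum_right add.commute)
qed

section \<open>Tolls, means and variances\<close>

text \<open>When the lower part has size \<open>j\<close>, the centered count for
  \<open>n + 1\<close> items is the sum of the two centered subcounts and this constant.\<close>

definition qs_toll :: "nat \<Rightarrow> nat \<Rightarrow> real" where
  "qs_toll n j = real n + qs_mean j + qs_mean (n - j) - qs_mean (Suc n)"

lemma qs_mean_0 [simp]: "qs_mean 0 = 0"
  by (simp add: qs_mean_def)

lemma qs_mean_Suc:
  "(real n + 1) * qs_mean (Suc n) = (real n + 2) * qs_mean n + 2 * real n"
  by (simp add: qs_mean_def field_simps)

text \<open>This is the recursion averaged over the pivot; it serves to identify the closed form
  with the expectation. Consecutive instances differ by \<open>qs_mean_Suc\<close>.\<close>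

lemma qs_mean_recurrence:
  "(real n + 1) * (qs_mean (Suc n) - real n) = 2 * (\<Sum>j\<le>n. qs_mean j)"
proof (induction n)
  case 0
  show ?case by (simp add: qs_mean_def)
next
  case (Suc n)
  have "(real n + 2) * qs_mean (Suc (Suc n)) = (real n + 3) * qs_mean (Suc n) + 2 * (real n + 1)"
    using qs_mean_Suc[of "Suc n"] by (simp add: algebra_simps)
  with Suc show ?case
    by (simp add: algebra_simps)
qed

lemma sum_qs_toll: "(\<Sum>j\<le>n. qs_toll n j) = 0"
proof -
  have rev: "(\<Sum>j\<le>n. qs_mean (n - j)) = (\<Sum>j\<le>n. qs_mean j)"
    by (rule sum.nat_diff_reindex[of qs_mean "Suc n", unfolded lessThan_Suc_atMost, simplified])
  show ?thesis
    using qs_mean_recurrence[of n]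
    by (simp add: qs_toll_def sum.distrib sum_subtractf rev algebra_simps)
qed

lemma expectation_qs: "measure_pmf.expectation (qs n) real = qs_mean n"
proof (induction n rule: less_induct)
  case (less n)
  show ?case
  proof (cases n)
    case 0
    then show ?thesis by (simp add: qs_0)
  next
    case (Suc m)
    have "measure_pmf.expectation (qs j) (\<lambda>a. measure_pmf.expectation (qs (m - j))
        (\<lambda>b. real (a + b + m))) = qs_toll m j + qs_mean (Suc m)" if "j \<le> m" for j
    proof -
      have "measure_pmf.expectation (qs j) real = qs_mean j"
        "measure_pmf.expectation (qs (m - j)) real = qs_mean (m - j)"
        using that Suc by (auto intro!: less)
      then show ?thesis by (simp add: qs_toll_def)
    qed
    then have "measure_pmf.expectation (qs n) real
        = (\<Sum>j\<le>m. qs_toll m j + qs_mean (Suc m)) /\<^sub>R (real m + 1)"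
      unfolding Suc expectation_qs_Suc by simp
    also have "(\<Sum>j\<le>m. qs_toll m j + qs_mean (Suc m)) = (real m + 1) * qs_mean (Suc m)"
      by (simp add: sum.distrib sum_qs_toll)
    finally show ?thesis
      by (simp add: Suc)
  qed
qed

lemma expectation_qs_centered:
  "measure_pmf.expectation (qs n) (\<lambda>x. real x - qs_mean n) = 0"
  by (simp add: expectation_qs)

definition qs_var :: "nat \<Rightarrow> real" where
  "qs_var n = measure_pmf.expectation (qs n) (\<lambda>x. (real x - qs_mean n)\<^sup>2)"

text \<open>Given the pivot, the deviation from the mean is a sum of two independent centered counts
  and the toll, so the cross terms vanish.\<close>

lemma qs_var_Suc:
  "qs_var (Suc n) = (2 * (\<Sum>j\<le>n. qs_var j) + (\<Sum>j\<le>n. (qs_toll n j)\<^sup>2)) / (real n + 1)"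
proof -
  have "measure_pmf.expectation (qs j) (\<lambda>a. measure_pmf.expectation (qs (n - j))
      (\<lambda>b. (real (a + b + n) - qs_mean (Suc n))\<^sup>2))
    = qs_var j + qs_var (n - j) + (qs_toll n j)\<^sup>2" for j
  proof -
    \<comment> \<open>Grouped for integrating over \<open>b\<close> first: terms free of
      \<open>b\<close>, a square, and a multiple of the centered \<open>b\<close>.\<close>
    have "(real (a + b + n) - qs_mean (Suc n))\<^sup>2
      = ((real a - qs_mean j)\<^sup>2 + (qs_toll n j)\<^sup>2 + 2 * (real a - qs_mean j) * qs_toll n j)
        + (real b - qs_mean (n - j))\<^sup>2
        + (2 * (real a - qs_mean j) + 2 * qs_toll n j) * (real b - qs_mean (n - j))" for a b
      by (simp add: qs_toll_def power2_eq_square algebra_simps)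
    then have "measure_pmf.expectation (qs (n - j)) (\<lambda>b. (real (a + b + n) - qs_mean (Suc n))\<^sup>2)
      = (real a - qs_mean j)\<^sup>2 + ((qs_toll n j)\<^sup>2 + qs_var (n - j))
         + 2 * qs_toll n j * (real a - qs_mean j)" for a
      by (simp add: Bochner_Integration.integral_add integrable_qs expectation_qs_centered qs_var_def
          del: Bochner_Integration.integral_diff of_nat_add)
    then show ?thesis
      by (simp add: Bochner_Integration.integral_add integrable_qs expectation_qs_centered
          qs_var_def[of j] del: Bochner_Integration.integral_diff of_nat_add)
  qed
  moreover have "(\<Sum>j\<le>n. qs_var (n - j)) = (\<Sum>j\<le>n. qs_var j)"
    by (rule sum.nat_diff_reindex[of qs_var "Suc n", unfolded lessThan_Suc_atMost, simplified])
  ultimately show ?thesis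
    unfolding qs_var_def[of "Suc n"] expectation_qs_Suc
    by (simp add: sum.distrib field_simps)
qed

section \<open>Bounds for the toll and the variance\<close>

lemma qs_mean_harm: "qs_mean n = 2 * (real n + 1) * harm (Suc n) - 4 * real n - 2"
  by (simp add: qs_mean_def harm_Suc harm_def[of n] inverse_eq_divide field_simps)

text \<open>The weights \<open>j + 1\<close> and \<open>n - j + 1\<close> add up to
  \<open>n + 2\<close>, so \<open>harm (n + 2)\<close> can be shared between the two parts; the
  differences that remain compare with logarithms.\<close>

lemma qs_toll_harm:
  assumes "j \<le> n"
  shows "qs_toll n j = (real n + 2) - 2 * ((real j + 1) * (harm (n + 2) - harm (j + 1))
    + (real (n - j) + 1) * (harm (n + 2) - harm (n - j + 1)))"
  using assms by (simp add: qs_toll_def qs_mean_harm of_nat_diff algebra_simps)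

text \<open>\<open>harm m - ln m\<close> decreases for positive \<open>m\<close>; the predecessors
  in the proof match the indexing of \<open>decseq_harm_diff_ln\<close>.\<close>

lemma harm_diff_le_ln:
  assumes "1 \<le> k" "k \<le> n"
  shows "harm n - harm k \<le> ln (real n / real k)"
proof -
  have "harm (Suc (n - 1)) - ln (real (Suc (n - 1))) \<le> harm (Suc (k - 1)) - ln (real (Suc (k - 1)))"
    using decseq_harm_diff_ln assms unfolding decseq_def by (meson diff_le_mono)
  with assms show ?thesis by (simp add: ln_div)
qed

lemma qs_toll_le:
  assumes "j \<le> n"
  shows "qs_toll n j \<le> real n + 2"
proof -
  have "(real i + 1) * (harm (n + 2) - harm (i + 1)) \<ge> 0" if "i \<le> n" for i
    using harm_mono[of "i + 1" "n + 2", where 'a = real] that by (intro mult_nonneg_nonneg) auto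
  from this[of j] this[of "n - j"] show ?thesis
    unfolding qs_toll_harm[OF assms] using assms by (smt (verit) diff_le_self)
qed

text \<open>The bound is the tangent at \<open>k = N / 2\<close> of the concave function
  \<open>k * ln (N / k)\<close>.\<close>

lemma mult_ln_div_le:
  assumes "0 < k" "0 < (N::real)"
  shows "k * ln (N / k) \<le> N / 2 - k + k * ln 2"
proof -
  have "ln (N / k) = ln (N / (2 * k)) + ln 2"
    using assms by (simp add: ln_div ln_mult)
  also have "ln (N / (2 * k)) \<le> N / (2 * k) - 1"
    using assms by (intro ln_le_minus_one) simp
  finally have "k * ln (N / k) \<le> k * (N / (2 * k) - 1 + ln 2)"
    using assms by (intro mult_left_mono) auto
  also have "\<dots> = N / 2 - k + k * ln 2"
    using assms by (simp add: distrib_left right_diff_distrib)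
  finally show ?thesis .
qed

text \<open>The two tangent bounds, at weights summing to \<open>n + 2\<close>, add up to
  \<open>(n + 2) * ln 2\<close>, the entropy of an even split. The constant is
  \<open>2 * (25 / 36) - 1 = 7 / 18\<close>.\<close>

lemma qs_toll_ge:
  assumes "j \<le> n"
  shows "qs_toll n j \<ge> - (7 / 18) * (real n + 2)"
proof -
  have *: "(real i + 1) * (harm (n + 2) - harm (i + 1))
      \<le> (real n + 2) / 2 - (real i + 1) + (real i + 1) * ln 2" if "i \<le> n" for i
  proof -
    have "(real i + 1) * (harm (n + 2) - harm (i + 1))
        \<le> (real i + 1) * ln ((real n + 2) / (real i + 1))"
      using harm_diff_le_ln[of "i + 1" "n + 2"] that by (intro mult_left_mono) (auto simp: add_ac)
    also have "\<dots> \<le> (real n + 2) / 2 - (real i + 1) + (real i + 1) * ln 2"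
      by (rule mult_ln_div_le) auto
    finally show ?thesis .
  qed
  define D :: real where "D = (real j + 1) * (harm (n + 2) - harm (j + 1))
      + (real (n - j) + 1) * (harm (n + 2) - harm (n - j + 1))"
  have "D \<le> (real n + 2) * ln 2"
  proof -
    have "real (n - j) = real n - real j"
      using assms by (simp add: of_nat_diff)
    then have "((real n + 2) / 2 - (real j + 1) + (real j + 1) * ln 2)
        + ((real n + 2) / 2 - (real (n - j) + 1) + (real (n - j) + 1) * ln 2) = (real n + 2) * ln 2"
      by (simp add: algebra_simps)
    then show ?thesis
      using *[of j] *[of "n - j"] assms unfolding D_def by linarith
  qed
  also have "\<dots> \<le> (real n + 2) * (25 / 36)"
    using ln2_le_25_over_36 by (intro mult_left_mono) auto
  finally show ?thesis
    using qs_toll_harm[OF assms, folded D_def] by (simp add: field_simps)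
qed

lemma sum_qs_toll_sq_le:
  "(\<Sum>j\<le>n. (qs_toll n j)\<^sup>2) \<le> (real n + 1) * (7 / 18 * (real n + 2)\<^sup>2)"
proof -
  let ?N = "real n + 2"
  \<comment> \<open>Values in \<open>[-b, N]\<close> with mean 0 have second moment at most \<open>b N\<close>.\<close>
  have "(qs_toll n j)\<^sup>2 \<le> (1 - 7 / 18) * ?N * qs_toll n j + 7 / 18 * ?N\<^sup>2" if "j \<le> n" for j
  proof -
    have "(?N - qs_toll n j) * (qs_toll n j + 7 / 18 * ?N) \<ge> 0"
      using qs_toll_le[OF that] qs_toll_ge[OF that] by (intro mult_nonneg_nonneg) auto
    then show ?thesis by (simp add: power2_eq_square field_simps)
  qed
  then have "(\<Sum>j\<le>n. (qs_toll n j)\<^sup>2) \<le> (\<Sum>j\<le>n. (1 - 7 / 18) * ?N * qs_toll n j + 7 / 18 * ?N\<^sup>2)"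
    by (intro sum_mono) auto
  also have "\<dots> = (1 - 7 / 18) * ?N * (\<Sum>j\<le>n. qs_toll n j) + (real n + 1) * (7 / 18 * ?N\<^sup>2)"
    by (simp add: sum.distrib sum_distrib_left)
  finally show ?thesis by (simp add: sum_qs_toll)
qed

text \<open>Averaging turns a bound \<open>c * (j + 1)^2\<close> into at most
  \<open>2 / 3 * c * (m + 2)^2\<close>, and the tolls add \<open>7 / 18 * (m + 2)^2\<close>; the
  induction closes for \<open>c = 2 / 3 * c + 7 / 18\<close>, that is
  \<open>c = 7 / 6\<close>.\<close>

lemma qs_var_le: "qs_var n \<le> 7 / 6 * (real n + 1)\<^sup>2"
proof (induction n rule: less_induct)
  case (less n)
  show ?case
  proof (cases n)
    case 0
    then show ?thesis by (simp add: qs_var_def qs_0)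
  next
    case (Suc m)
    have sq: "(\<Sum>j\<le>m. (real j + 1)\<^sup>2) = (real m + 1) * (real m + 2) * (2 * real m + 3) / 6"
      by (induction m) (auto simp: power2_eq_square field_simps)
    have "(\<Sum>j\<le>m. qs_var j) \<le> (\<Sum>j\<le>m. 7 / 6 * (real j + 1)\<^sup>2)"
      using less Suc by (intro sum_mono) auto
    also have "\<dots> = 7 / 6 * ((real m + 1) * (real m + 2) * (2 * real m + 3) / 6)"
      by (simp only: sum_distrib_left[symmetric] sq)
    finally have "qs_var n * (real m + 1) \<le> 2 * (7 / 6 * ((real m + 1) * (real m + 2) * (2 * real m + 3) / 6))
        + (real m + 1) * (7 / 18 * (real m + 2)\<^sup>2)"
      using sum_qs_toll_sq_le[of m] by (simp add: Suc qs_var_Suc)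
    also have "\<dots> \<le> 7 / 6 * (real n + 1)\<^sup>2 * (real m + 1)"
      by (simp add: Suc power2_eq_square field_simps)
    finally show ?thesis by simp
  qed
qed

section \<open>A large atom\<close>

text \<open>Each summand is the integral of \<open>R^2 - (x - c)^2\<close> over the unit interval
  centered at \<open>k\<close>, the \<open>1 / 12\<close> being the variance of that interval; so
  the sum telescopes.\<close>

lemma sum_parabola:
  assumes "a \<le> b"
  shows "(\<Sum>k=a..b. R\<^sup>2 - 1 / 12 - (real k - c)\<^sup>2)
    = (R\<^sup>2 * (real b + 1 / 2 - c) - (real b + 1 / 2 - c) ^ 3 / 3)
      - (R\<^sup>2 * (real a - 1 / 2 - c) - (real a - 1 / 2 - c) ^ 3 / 3)"
  using assms
proof (induction b rule: dec_induct)
  case base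
  show ?case by (simp add: power2_eq_square power3_eq_cube field_simps)
next
  case (step b)
  then show ?case
    by (simp add: sum.atLeast_Suc_atMost_Suc_shift sum.nat_ivl_Suc' power2_eq_square power3_eq_cube field_simps)
qed

text \<open>The value \<open>2 / 3 * R ^ 3\<close> is attained at \<open>x = R\<close>, a double
  root of the difference, whose third root is \<open>- 2 * R\<close>.\<close>

lemma parabola_antiderivative_le:
  assumes "- 2 * R \<le> (x::real)"
  shows "R\<^sup>2 * x - x ^ 3 / 3 \<le> 2 / 3 * R ^ 3"
proof -
  have "(x - R)\<^sup>2 * (x + 2 * R) \<ge> 0"
    using assms by (intro mult_nonneg_nonneg) auto
  then show ?thesis by (simp add: power2_eq_square power3_eq_cube field_simps)
qed

lemma parabola_antiderivative_ge:
  assumes "(x::real) \<le> 2 * R"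
  shows "- (2 / 3 * R ^ 3) \<le> R\<^sup>2 * x - x ^ 3 / 3"
  using parabola_antiderivative_le[of R "- x"] assms by simp

text \<open>The bound is the area under \<open>R^2 - x^2\<close> on \<open>[-R, R]\<close>. The
  shifted endpoints stay in the ranges where the antiderivative bounds hold.\<close>

lemma sum_parabola_le:
  assumes "\<And>k. k \<in> {a..b} \<Longrightarrow> \<bar>real k - c\<bar> \<le> R" "R \<ge> 1 / 2"
  shows "(\<Sum>k=a..b. R\<^sup>2 - 1 / 12 - (real k - c)\<^sup>2) \<le> 4 / 3 * R ^ 3"
proof (cases "a \<le> b")
  case True
  then have "\<bar>real a - c\<bar> \<le> R" "\<bar>real b - c\<bar> \<le> R"
    using assms by auto
  then have "- 2 * R \<le> real b + 1 / 2 - c" "real a - 1 / 2 - c \<le> 2 * R"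
    using assms by (auto simp: abs_le_iff)
  from parabola_antiderivative_le[OF this(1)] parabola_antiderivative_ge[OF this(2)] show ?thesis
    unfolding sum_parabola[OF True] by linarith
qed (use assms in simp)

text \<open>Among the laws on the integers with atoms at most \<open>p\<close>, the uniform law on an
  interval minimises the second moment; testing with a truncated parabola gives a lower bound.\<close>
lemma pmf_nat_second_moment_ge:
  fixes M :: "nat pmf"
  assumes fin: "finite (set_pmf M)" and p: "\<And>k. pmf M k \<le> p" and R: "R \<ge> 1 / 2"
  shows "R\<^sup>2 - 1 / 12 - measure_pmf.expectation M (\<lambda>k. (real k - c)\<^sup>2) \<le> p * (4 / 3 * R ^ 3)"
proof -
  define h where "h k = R\<^sup>2 - 1 / 12 - (real k - c)\<^sup>2" for k
  define K where "K = {k. 0 < h k}"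
  have K_abs: "\<bar>real k - c\<bar> \<le> R" if "k \<in> K" for k
  proof -
    have "(real k - c)\<^sup>2 \<le> R\<^sup>2" using that by (simp add: K_def h_def)
    then show ?thesis using R by (simp add: abs_le_square_iff[symmetric])
  qed
  have p_nonneg: "0 \<le> p" using p[of 0] pmf_nonneg[of M 0] by linarith
  have K_fin: "finite K"
  proof (rule finite_subset)
    show "K \<subseteq> {..nat \<lfloor>c + R\<rfloor>}"
    proof
      fix k assume "k \<in> K"
      from K_abs[OF this] have "int k \<le> \<lfloor>c + R\<rfloor>" by (simp add: le_floor_iff)
      then show "k \<in> {..nat \<lfloor>c + R\<rfloor>}" by simp
    qed
  qed simp
  have sum_K: "(\<Sum>k\<in>K. h k) \<le> 4 / 3 * R ^ 3"
  proof (cases "K = {}")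
    case True
    then show ?thesis using R by simp
  next
    case False
    define a b where "a = Min K" and "b = Max K"
    have ab: "a \<in> K" "b \<in> K" using False K_fin by (auto simp: a_def b_def)
    \<comment> \<open>A concave function is positive on an interval: between \<open>a\<close> and
      \<open>b\<close> the distance to \<open>c\<close> is at most that of one endpoint.\<close>
    have "K = {a..b}"
    proof
      show "K \<subseteq> {a..b}" using K_fin by (auto simp: a_def b_def)
      show "{a..b} \<subseteq> K"
      proof
        fix k assume k: "k \<in> {a..b}"
        have "(real k - c)\<^sup>2 \<le> max ((real a - c)\<^sup>2) ((real b - c)\<^sup>2)"
        proof (cases "real k \<ge> c")
          case True
          then show ?thesis using k by (intro max.coboundedI2 power_mono) auto
        next
          case False
          then have "(c - real k)\<^sup>2 \<le> (c - real a)\<^sup>2" using k by (intro power_mono) auto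
          then show ?thesis by (simp add: power2_commute max.coboundedI1)
        qed
        with ab show "k \<in> K" by (auto simp: K_def h_def max_def split: if_splits)
      qed
    qed
    then show ?thesis
      using sum_parabola_le[of a b c R] K_abs R by (simp add: h_def)
  qed
  have "R\<^sup>2 - 1 / 12 - measure_pmf.expectation M (\<lambda>k. (real k - c)\<^sup>2) = measure_pmf.expectation M h"
    unfolding h_def by (simp add: integrable_measure_pmf_finite[OF fin])
  also have "\<dots> = (\<Sum>k\<in>set_pmf M \<union> K. pmf M k * h k)"
    using fin K_fin by (subst integral_measure_pmf[where A = "set_pmf M \<union> K"]) auto
  \<comment> \<open>Where \<open>h\<close> is positive the atom is replaced by \<open>p\<close>;
    elsewhere the term is at most 0 and is dropped.\<close>
  also have "\<dots> \<le> (\<Sum>k\<in>set_pmf M \<union> K. if k \<in> K then p * h k else 0)"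
    using p by (intro sum_mono) (auto simp: K_def mult_right_mono mult_le_0_iff not_less)
  also have "\<dots> = p * (\<Sum>k\<in>K. h k)"
    using fin K_fin by (simp add: sum.If_cases sum_distrib_left Int_absorb1 Int_commute)
  also have "\<dots> \<le> p * (4 / 3 * R ^ 3)"
    using sum_K p_nonneg by (rule mult_left_mono)
  finally show ?thesis .
qed

lemma qs_large_atom:
  assumes "n \<ge> 1"
  obtains k where "pmf (qs n) k > 1 / (4 * (real n + 1))"
proof (rule ccontr)
  assume "\<not> thesis"
  with that have "pmf (qs n) k \<le> 1 / (4 * (real n + 1))" for k
    by (meson not_le)
  \<comment> \<open>With \<open>p = 1 / (4 * (n + 1))\<close> the extremal uniform law has width
    \<open>1 / p\<close>, so the half-width \<open>R = 2 * (n + 1)\<close> is chosen.\<close>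
  then have "(2 * (real n + 1))\<^sup>2 - 1 / 12 - qs_var n
      \<le> 1 / (4 * (real n + 1)) * (4 / 3 * (2 * (real n + 1)) ^ 3)"
    unfolding qs_var_def by (intro pmf_nat_second_moment_ge) auto
  also have "\<dots> = 8 / 3 * (real n + 1)\<^sup>2"
    by (simp add: power2_eq_square power3_eq_cube field_simps)
  \<comment> \<open>Here \<open>4 - 8 / 3 - 7 / 6 = 1 / 6\<close>.\<close>
  finally have "1 / 6 * (real n + 1)\<^sup>2 \<le> 1 / 12"
    using qs_var_le[of n] unfolding power_mult_distrib by simp
  moreover have "(real n + 1)\<^sup>2 \<ge> 1" by (rule one_le_power) simp
  ultimately show False by linarith
qed

section \<open>From an atom to the Kolmogorov-Smirnov distance\<close>

lemma real_distribution_Y_law: "real_distribution (Y_law n)"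
  unfolding Y_law_def by (intro prob_space.real_distribution_distr prob_space_measure_pmf) auto

text \<open>Across \<open>x\<close> the first distribution function rises by the atom while the
  second is continuous, so the gap at \<open>x\<close> and the gap just left of it together account
  for the atom.\<close>

lemma jump_le_twice_d_KS:
  assumes M: "real_distribution M" and N: "real_distribution N" and x: "measure N {x} = 0"
  shows "measure M {x} \<le> 2 * d_KS M N"
proof -
  interpret M: real_distribution M by (rule M)
  interpret N: real_distribution N by (rule N)
  have le: "\<bar>cdf M y - cdf N y\<bar> \<le> d_KS M N" for y
    unfolding d_KS_def
  proof (rule cSUP_upper)
    show "bdd_above (range (\<lambda>x. \<bar>cdf M x - cdf N x\<bar>))"
    proof (rule bdd_aboveI2)
      fix y show "\<bar>cdf M y - cdf N y\<bar> \<le> 1"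
        using M.cdf_bounded_prob[of y] N.cdf_bounded_prob[of y] M.cdf_nonneg[of y] N.cdf_nonneg[of y]
        by linarith
    qed
  qed simp
  have "measure M {x} - 2 * d_KS M N \<le> cdf N x - cdf N y" if "y < x" for y
  proof -
    have "measure M {x} \<le> measure M {y<..x}"
      using that by (intro M.finite_measure_mono) auto
    with M.cdf_diff_eq[OF that] le[of x] le[of y] show ?thesis by linarith
  qed
  moreover have "((\<lambda>y. cdf N x - cdf N y) \<longlongrightarrow> cdf N x - cdf N x) (at_left x)"
    using x N.isCont_cdf[of x]
    by (intro tendsto_intros) (auto simp: isCont_def filterlim_at_split)
  ultimately have "measure M {x} - 2 * d_KS M N \<le> cdf N x - cdf N x"
    by (intro tendsto_lowerbound) (auto simp: eventually_at_left_field intro: lt_ex)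
  then show ?thesis by simp
qed

lemma measure_Y_law_singleton:
  assumes "n \<ge> 1"
  shows "measure (Y_law n) {(real k - qs_mean n) / real n} = pmf (qs n) k"
proof -
  have "(\<lambda>x. (real x - qs_mean n) / real n) -` {(real k - qs_mean n) / real n} = {k}"
    using assms by auto
  then show ?thesis
    unfolding Y_law_def by (subst measure_distr) (auto simp: measure_pmf_single)
qed

section \<open>The limit law\<close>

text \<open>In the recursion both the index and the argument move with \<open>n\<close>. A Skorohod
  coupling makes the variables converge pointwise, and dominated convergence then handles both at
  once.\<close>

lemma tendsto_char_weak_conv:
  assumes M: "\<And>n. real_distribution (M n)" and N: "real_distribution N"
    and conv: "weak_conv_m M N" and s: "s \<longlonglongrightarrow> t"
    and j: "filterlim j at_top sequentially"
  shows "(\<lambda>n. char (M (j n)) (s n)) \<longlonglongrightarrow> char N t"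
proof -
  from Skorohod[OF M N conv] obtain \<Omega> :: "real measure" and Z :: "nat \<Rightarrow> real \<Rightarrow> real" and W
    where *: "prob_space \<Omega> \<and> (\<forall>n. Z n \<in> measurable \<Omega> borel) \<and> (\<forall>n. distr \<Omega> borel (Z n) = M n)
      \<and> W \<in> measurable \<Omega> lborel \<and> distr \<Omega> borel W = N
      \<and> (\<forall>x \<in> space \<Omega>. (\<lambda>n. Z n x) \<longlonglongrightarrow> W x)"
    by blast
  then have \<Omega>: "prob_space \<Omega>" and Z [measurable]: "\<And>n. Z n \<in> measurable \<Omega> borel"
    and Zd: "\<And>n. distr \<Omega> borel (Z n) = M n" and W [measurable]: "W \<in> measurable \<Omega> borel"
    and Wd: "distr \<Omega> borel W = N" and lim: "\<And>x. x \<in> space \<Omega> \<Longrightarrow> (\<lambda>n. Z n x) \<longlonglongrightarrow> W x"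
    by auto
  interpret prob_space \<Omega> by (rule \<Omega>)
  have "(\<lambda>n. CLINT x|\<Omega>. iexp (s n * Z (j n) x)) \<longlonglongrightarrow> (CLINT x|\<Omega>. iexp (t * W x))"
  proof (rule integral_dominated_convergence[where w = "\<lambda>_. 1"])
    show "AE x in \<Omega>. (\<lambda>n. iexp (s n * Z (j n) x)) \<longlonglongrightarrow> iexp (t * W x)"
    proof (rule AE_I2)
      fix x assume "x \<in> space \<Omega>"
      from filterlim_compose[OF lim[OF this] j] s
      show "(\<lambda>n. iexp (s n * Z (j n) x)) \<longlonglongrightarrow> iexp (t * W x)"
        by (intro tendsto_intros)
    qed
  qed auto
  moreover have "char (M (j n)) (s n) = (CLINT x|\<Omega>. iexp (s n * Z (j n) x))" for n
    unfolding char_def Zd[symmetric] by (subst integral_distr) auto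
  moreover have "char N t = (CLINT x|\<Omega>. iexp (t * W x))"
    unfolding char_def Wd[symmetric] by (subst integral_distr) auto
  ultimately show ?thesis by simp
qed

section \<open>The recursion for characteristic functions\<close>

lemma char_Y_law:
  "char (Y_law n) t = measure_pmf.expectation (qs n) (\<lambda>x. iexp (t * ((real x - qs_mean n) / real n)))"
  unfolding char_def Y_law_def by (subst integral_distr) auto

lemma char_Y_law_scaled:
  assumes "j \<le> n"
  shows "char (Y_law j) (t * (real j / (real n + 1)))
    = measure_pmf.expectation (qs j) (\<lambda>x. iexp (t * ((real x - qs_mean j) / (real n + 1))))"
  \<comment> \<open>For \<open>j = 0\<close> division by zero makes \<open>Y_law 0\<close> the point
    mass at 0, and both sides are 1; otherwise the factor \<open>j\<close> cancels.\<close>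
  by (cases "j = 0") (simp_all add: char_Y_law qs_0)

text \<open>Given the pivot the two subcounts are independent, so the exponential factors into their
  characteristic functions and a toll phase.\<close>

lemma char_Y_law_Suc:
  "char (Y_law (Suc n)) t = (\<Sum>j\<le>n. char (Y_law j) (t * (real j / (real n + 1)))
      * char (Y_law (n - j)) (t * (real (n - j) / (real n + 1))) * iexp (t * (qs_toll n j / (real n + 1))))
     /\<^sub>R (real n + 1)"
proof -
  have *: "measure_pmf.expectation (qs j) (\<lambda>a. measure_pmf.expectation (qs (n - j)) (\<lambda>b.
      iexp (t * ((real (a + b + n) - qs_mean (Suc n)) / real (Suc n)))))
    = char (Y_law j) (t * (real j / (real n + 1)))
      * char (Y_law (n - j)) (t * (real (n - j) / (real n + 1))) * iexp (t * (qs_toll n j / (real n + 1)))"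
    if "j \<le> n" for j
  proof -
    have "iexp (t * ((real (a + b + n) - qs_mean (Suc n)) / real (Suc n)))
      = (iexp (t * (qs_toll n j / (real n + 1))) * iexp (t * ((real a - qs_mean j) / (real n + 1))))
        * iexp (t * ((real b - qs_mean (n - j)) / (real n + 1)))" for a b
      by (simp add: exp_add[symmetric] qs_toll_def distrib_left[symmetric] of_real_add[symmetric]
          add_divide_distrib[symmetric] del: of_real_add of_real_mult of_real_divide of_real_diff of_real_of_nat_eq)
         (simp add: algebra_simps)
    then show ?thesis
      unfolding char_Y_law_scaled[OF that] char_Y_law_scaled[OF diff_le_self]
      by (simp add: integrable_qs del: of_real_mult of_real_divide of_real_diff)
  qed
  show ?thesis
    unfolding char_Y_law[of "Suc n"] expectation_qs_Suc
    by (intro arg_cong[where f = "\<lambda>z. z /\<^sub>R (real n + 1)"] sum.cong refl *) simp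
qed

section \<open>The pivot as the floor of a uniform variable\<close>

text \<open>The open interval excludes the endpoints, so the later limits hold at every point of the
  space.\<close>

definition unit_uniform :: "real measure" where
  "unit_uniform = restrict_space lborel {0<..<1}"

lemma space_unit_uniform [simp]: "space unit_uniform = {0<..<1}"
  by (simp add: unit_uniform_def space_restrict_space)

lemma measurable_unit_uniform [measurable (raw)]:
  "f \<in> measurable borel N \<Longrightarrow> f \<in> measurable unit_uniform N"
  unfolding unit_uniform_def by (intro measurable_restrict_space1) simp

lemma prob_space_unit_uniform: "prob_space unit_uniform"
  unfolding unit_uniform_def by (intro prob_space_restrict_space) auto

lemma nat_floor_le:
  assumes "u < 1"
  shows "nat \<lfloor>(real n + 1) * u\<rfloor> \<le> n"
proof -
  have "(real n + 1) * u < (real n + 1) * 1"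
    using assms by (intro mult_strict_left_mono) auto
  then have "\<lfloor>(real n + 1) * u\<rfloor> < int (Suc n)"
    by (simp only: floor_less_iff of_int_of_nat_eq of_nat_Suc mult_1_right add.commute)
  then show ?thesis by simp
qed

text \<open>The floor of \<open>(n + 1) * u\<close> is uniform on \<open>{..n}\<close>. The average
  over pivots thus becomes an integral over a space that does not depend on \<open>n\<close>, ready
  for dominated convergence.\<close>

lemma integral_unit_uniform_floor:
  fixes f :: "nat \<Rightarrow> complex"
  shows "(CLINT u|unit_uniform. f (nat \<lfloor>(real n + 1) * u\<rfloor>)) = (\<Sum>j\<le>n. f j) /\<^sub>R (real n + 1)"
proof -
  have ind: "indicator {0<..<1} u *\<^sub>R f (nat \<lfloor>(real n + 1) * u\<rfloor>)
      = (\<Sum>j\<le>n. indicator ({0<..<1} \<inter> {real j / (real n + 1)..<(real j + 1) / (real n + 1)}) u *\<^sub>R f j)" for u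
  proof (cases "u \<in> {0<..<1}")
    case True
    define i where "i = nat \<lfloor>(real n + 1) * u\<rfloor>"
    have i: "i \<le> n" using True nat_floor_le[of u n] by (simp add: i_def)
    have mem: "u \<in> {real j / (real n + 1)..<(real j + 1) / (real n + 1)} \<longleftrightarrow> j = i" for j
    proof -
      have "u \<in> {real j / (real n + 1)..<(real j + 1) / (real n + 1)} \<longleftrightarrow>
          real j \<le> (real n + 1) * u \<and> (real n + 1) * u < real j + 1"
        by (simp add: field_simps)
      also have "\<dots> \<longleftrightarrow> \<lfloor>(real n + 1) * u\<rfloor> = int j"
        by (simp add: floor_eq_iff)
      also have "\<dots> \<longleftrightarrow> j = i"
        using True by (auto simp: i_def)
      finally show ?thesis .
    qed
    have "(\<Sum>j\<le>n. indicator ({0<..<1} \<inter> {real j / (real n + 1)..<(real j + 1) / (real n + 1)}) u *\<^sub>R f j)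
      = (\<Sum>j\<le>n. if j = i then f j else 0)"
      using True by (intro sum.cong) (auto simp: indicator_def mem simp del: atLeastLessThan_iff)
    then show ?thesis using True i by (simp add: i_def)
  next
    case False
    then show ?thesis by (subst sum.neutral) (auto simp: indicator_def)
  qed
  have meas: "measure lborel ({0<..<1} \<inter> {real j / (real n + 1)..<(real j + 1) / (real n + 1)}) = 1 / (real n + 1)"
    if "j \<le> n" for j
  proof (cases "j = 0")
    \<comment> \<open>The first cell loses the point 0 to the open unit interval, so it is not
      half-open like the others.\<close>
    case True
    have "1 / (real n + 1) \<le> 1" by simp
    with True have "{0<..<1} \<inter> {real j / (real n + 1)..<(real j + 1) / (real n + 1)} = {0<..<1 / (real n + 1)}"
      by (auto simp del: divide_le_eq_1_pos le_divide_eq_1 divide_le_eq_1 intro: less_le_trans)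
    then show ?thesis by simp
  next
    case False
    have "{0<..<1} \<inter> {a..<b} = {a..<b}" if "0 < a" "b \<le> 1" for a b :: real
      using that by auto
    moreover have "0 < real j / (real n + 1)" "(real j + 1) / (real n + 1) \<le> 1"
      using False that by simp_all
    ultimately have "{0<..<1} \<inter> {real j / (real n + 1)..<(real j + 1) / (real n + 1)}
        = {real j / (real n + 1)..<(real j + 1) / (real n + 1)}"
      by blast
    then show ?thesis by (simp add: divide_right_mono diff_divide_distrib[symmetric])
  qed
  have fin: "emeasure lborel ({0<..<1} \<inter> {real j / (real n + 1)..<(real j + 1) / (real n + 1)}) < \<infinity>" for j
    by (rule le_less_trans[OF emeasure_mono[of _ "{0<..<1}"]]) auto
  define A where "A j = {0<..<1} \<inter> {real j / (real n + 1)..<(real j + 1) / (real n + 1)}" for j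
  have A [measurable]: "A j \<in> sets lborel" for j
    by (simp add: A_def)
  have "(CLINT u|unit_uniform. f (nat \<lfloor>(real n + 1) * u\<rfloor>))
      = (CLINT u|lborel. (\<Sum>j\<le>n. indicator (A j) u *\<^sub>R f j))"
    unfolding unit_uniform_def by (subst integral_restrict_space) (simp_all only: ind A_def, simp)
  also have "\<dots> = (\<Sum>j\<le>n. CLINT u|lborel. indicator (A j) u *\<^sub>R f j)"
    using fin by (intro Bochner_Integration.integral_sum integrable_scaleR_left integrable_real_indicator)
      (simp_all add: A_def)
  also have "\<dots> = (\<Sum>j\<le>n. f j /\<^sub>R (real n + 1))"
    using meas fin by (intro sum.cong refl) (simp add: A_def inverse_eq_divide)
  finally show ?thesis by (simp add: scaleR_sum_right)
qed

section \<open>The limit of the scaled toll\<close>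

text \<open>This is the function \<open>C\<close> of the distributional equation for the
  limit.\<close>

definition qs_limit_toll :: "real \<Rightarrow> real" where
  "qs_limit_toll u = 1 + 2 * (u * ln u + (1 - u) * ln (1 - u))"

text \<open>Both harmonic numbers equal a logarithm plus Euler's constant in the limit; the
  constants cancel and the logarithm of the ratio remains.\<close>

lemma tendsto_harm_diff:
  assumes k: "filterlim k at_top sequentially" and c: "(\<lambda>n. real (k n) / real (n + 2)) \<longlonglongrightarrow> c" "c > 0"
  shows "(\<lambda>n. harm (n + 2) - harm (k n)) \<longlonglongrightarrow> - ln c"
proof -
  have *: "(\<lambda>n. harm (k n) - ln (real (k n))) \<longlonglongrightarrow> (euler_mascheroni :: real)"
    using filterlim_compose[OF euler_mascheroni_LIMSEQ k] by simp
  have **: "(\<lambda>n. harm (n + 2) - ln (real (n + 2))) \<longlonglongrightarrow> (euler_mascheroni :: real)"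
    using LIMSEQ_ignore_initial_segment[OF euler_mascheroni_LIMSEQ, of 2] by simp
  have "(\<lambda>n. (harm (n + 2) - ln (real (n + 2))) - (harm (k n) - ln (real (k n)))
      - ln (real (k n) / real (n + 2))) \<longlonglongrightarrow> euler_mascheroni - euler_mascheroni - ln c"
    using c by (intro tendsto_intros * **) auto
  moreover have "eventually (\<lambda>n. (harm (n + 2) - ln (real (n + 2))) - (harm (k n) - ln (real (k n)))
      - ln (real (k n) / real (n + 2)) = harm (n + 2) - harm (k n)) sequentially"
    using eventually_compose_filterlim[OF eventually_gt_at_top[of 0] k]
    by eventually_elim (simp add: ln_div)
  ultimately have "(\<lambda>n. harm (n + 2) - harm (k n)) \<longlonglongrightarrow> euler_mascheroni - euler_mascheroni - ln c"
    by (rule Lim_transform_eventually)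
  then show ?thesis by simp
qed

lemma tendsto_nat_floor_ratio:
  assumes "0 < (u::real)"
  shows "(\<lambda>n. real (nat \<lfloor>(real n + 1) * u\<rfloor>) / (real n + 1)) \<longlonglongrightarrow> u"
proof (rule real_tendsto_sandwich[where f = "\<lambda>n. u - 1 / (real n + 1)" and h = "\<lambda>n. u"])
  have fl: "real (nat \<lfloor>(real n + 1) * u\<rfloor>) = real_of_int \<lfloor>(real n + 1) * u\<rfloor>" for n
    using assms by simp
  show "\<forall>\<^sub>F n in sequentially. u - 1 / (real n + 1) \<le> real (nat \<lfloor>(real n + 1) * u\<rfloor>) / (real n + 1)"
  proof (rule always_eventually, rule allI)
    fix n
    have "(real n + 1) * u - 1 \<le> real (nat \<lfloor>(real n + 1) * u\<rfloor>)" unfolding fl by linarith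
    from divide_right_mono[OF this, of "real n + 1"]
    show "u - 1 / (real n + 1) \<le> real (nat \<lfloor>(real n + 1) * u\<rfloor>) / (real n + 1)"
      by (simp add: diff_divide_distrib)
  qed
  show "\<forall>\<^sub>F n in sequentially. real (nat \<lfloor>(real n + 1) * u\<rfloor>) / (real n + 1) \<le> u"
  proof (rule always_eventually, rule allI)
    fix n
    have "real (nat \<lfloor>(real n + 1) * u\<rfloor>) \<le> (real n + 1) * u" unfolding fl by linarith
    then show "real (nat \<lfloor>(real n + 1) * u\<rfloor>) / (real n + 1) \<le> u"
      by (simp add: field_simps)
  qed
  show "(\<lambda>n. u - 1 / (real n + 1)) \<longlonglongrightarrow> u"
    by real_asymp
qed simp

lemma tendsto_nat_floor_ratio_compl:
  assumes "0 < (u::real)" "u < 1"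
  shows "(\<lambda>n. real (n - nat \<lfloor>(real n + 1) * u\<rfloor>) / (real n + 1)) \<longlonglongrightarrow> 1 - u"
proof -
  have "(\<lambda>n. real n / (real n + 1) - real (nat \<lfloor>(real n + 1) * u\<rfloor>) / (real n + 1)) \<longlonglongrightarrow> 1 - u"
    by (intro tendsto_diff tendsto_nat_floor_ratio assms) real_asymp
  then show ?thesis
    by (simp only: of_nat_diff[OF nat_floor_le[OF assms(2)]] diff_divide_distrib)
qed

context
  fixes k :: "nat \<Rightarrow> nat" and c :: real
  assumes lim: "(\<lambda>n. real (k n) / (real n + 1)) \<longlonglongrightarrow> c"
begin

lemma filterlim_at_top_of_ratio:
  assumes "c > 0"
  shows "filterlim k at_top sequentially"
proof -
  have "filterlim (\<lambda>n. real (k n) / (real n + 1) * (real n + 1)) at_top sequentially"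
    by (rule filterlim_tendsto_pos_mult_at_top[OF lim assms]) real_asymp
  then show ?thesis
    by (simp add: filterlim_sequentially_iff_filterlim_real add_nonneg_eq_0_iff)
qed

lemma tendsto_ratio_Suc: "(\<lambda>n. (real (k n) + 1) / (real n + 1)) \<longlonglongrightarrow> c"
proof -
  have "(\<lambda>n. real (k n) / (real n + 1) + 1 / (real n + 1)) \<longlonglongrightarrow> c + 0"
    by (intro tendsto_add lim) real_asymp
  then show ?thesis by (simp add: add_divide_distrib)
qed

text \<open>One half of the scaled toll; it is applied to the floor of \<open>(n + 1) * u\<close>
  with \<open>c = u\<close> and to its complement in \<open>n\<close> with
  \<open>c = 1 - u\<close>.\<close>

lemma tendsto_mult_harm_diff:
  assumes "c > 0"
  shows "(\<lambda>n. (real (k n) + 1) / (real n + 1) * (harm (n + 2) - harm (k n + 1))) \<longlonglongrightarrow> c * (- ln c)"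
proof (intro tendsto_mult tendsto_ratio_Suc tendsto_harm_diff assms)
  have "(\<lambda>n. (real (k n) + 1) / (real n + 1) * ((real n + 1) / (real n + 2))) \<longlonglongrightarrow> c * 1"
    by (intro tendsto_mult tendsto_ratio_Suc) real_asymp
  moreover have "(real (k n) + 1) / (real n + 1) * ((real n + 1) / (real n + 2))
      = real (k n + 1) / real (n + 2)" for n
    by (simp add: add.commute)
  ultimately show "(\<lambda>n. real (k n + 1) / real (n + 2)) \<longlonglongrightarrow> c" by simp
  show "filterlim (\<lambda>n. k n + 1) at_top sequentially"
    using filterlim_compose[OF filterlim_Suc filterlim_at_top_of_ratio[OF assms]] by simp
qed

end

lemma tendsto_qs_toll:
  assumes u: "0 < u" "u < 1"
  shows "(\<lambda>n. qs_toll n (nat \<lfloor>(real n + 1) * u\<rfloor>) / (real n + 1)) \<longlonglongrightarrow> qs_limit_toll u"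
proof -
  define j where "j n = nat \<lfloor>(real n + 1) * u\<rfloor>" for n
  have "(\<lambda>n. (real n + 2) / (real n + 1)
      - 2 * ((real (j n) + 1) / (real n + 1) * (harm (n + 2) - harm (j n + 1))
      + (real (n - j n) + 1) / (real n + 1) * (harm (n + 2) - harm (n - j n + 1))))
    \<longlonglongrightarrow> 1 - 2 * (u * (- ln u) + (1 - u) * (- ln (1 - u)))"
    unfolding j_def
    by (intro tendsto_diff tendsto_mult_left tendsto_add tendsto_mult_harm_diff
        tendsto_nat_floor_ratio tendsto_nat_floor_ratio_compl) (use u in simp_all, real_asymp)
  moreover have arith: "a / d - 2 * (x / d * p + y / d * q) = (a - 2 * (x * p + y * q)) / d"
    for a d x y p q :: real
    by (simp add: diff_divide_distrib add_divide_distrib distrib_left)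
  have "(real n + 2) / (real n + 1)
      - 2 * ((real (j n) + 1) / (real n + 1) * (harm (n + 2) - harm (j n + 1))
      + (real (n - j n) + 1) / (real n + 1) * (harm (n + 2) - harm (n - j n + 1)))
      = qs_toll n (j n) / (real n + 1)" for n
    unfolding qs_toll_harm[OF nat_floor_le[OF u(2)], of n, folded j_def]
    by (rule arith)
  moreover have "1 - 2 * (u * (- ln u) + (1 - u) * (- ln (1 - u))) = qs_limit_toll u"
    by (simp add: qs_limit_toll_def algebra_simps)
  ultimately show ?thesis
    by (simp only: j_def)
qed

section \<open>The fixed-point equation\<close>

lemma borel_measurable_qs_limit_toll [measurable]: "qs_limit_toll \<in> borel_measurable borel"
  unfolding qs_limit_toll_def by measurable

lemma (in real_distribution) borel_measurable_char [measurable]: "char M \<in> borel_measurable borel"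
  by (intro borel_measurable_continuous_onI continuous_at_imp_continuous_on ballI isCont_char)

text \<open>Both sides are limits of \<open>char (Y_law (Suc n)) t\<close>: one by weak convergence,
  the other by passing to the limit under the integral form of the recursion, whose integrand has
  norm at most 1.\<close>

lemma char_limit_fixed_point:
  assumes Y: "real_distribution Y" and conv: "weak_conv_m Y_law Y"
  shows "char Y t = (CLINT u|unit_uniform. char Y (t * u) * char Y (t * (1 - u)) * iexp (t * qs_limit_toll u))"
proof (rule LIMSEQ_unique)
  interpret Y: real_distribution Y by (rule Y)
  interpret U: prob_space unit_uniform by (rule prob_space_unit_uniform)
  note lim = tendsto_char_weak_conv[OF real_distribution_Y_law Y conv]
  show "(\<lambda>n. char (Y_law (Suc n)) t) \<longlonglongrightarrow> char Y t"
    by (rule lim[OF tendsto_const filterlim_Suc])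
  define F where "F n j = char (Y_law j) (t * (real j / (real n + 1)))
      * char (Y_law (n - j)) (t * (real (n - j) / (real n + 1))) * iexp (t * (qs_toll n j / (real n + 1)))"
    for n j
  have "(\<lambda>n. CLINT u|unit_uniform. F n (nat \<lfloor>(real n + 1) * u\<rfloor>)) \<longlonglongrightarrow>
      (CLINT u|unit_uniform. char Y (t * u) * char Y (t * (1 - u)) * iexp (t * qs_limit_toll u))"
  proof (rule integral_dominated_convergence[where w = "\<lambda>_. 1"])
    show "(\<lambda>u. char Y (t * u) * char Y (t * (1 - u)) * iexp (t * qs_limit_toll u))
        \<in> borel_measurable unit_uniform"
      by (rule measurable_unit_uniform) measurable
    show "(\<lambda>u. F n (nat \<lfloor>(real n + 1) * u\<rfloor>)) \<in> borel_measurable unit_uniform" for n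
      by (rule measurable_unit_uniform) measurable
    show "AE u in unit_uniform. (\<lambda>n. F n (nat \<lfloor>(real n + 1) * u\<rfloor>))
        \<longlonglongrightarrow> char Y (t * u) * char Y (t * (1 - u)) * iexp (t * qs_limit_toll u)"
    proof (rule AE_I2)
      fix u assume "u \<in> space unit_uniform"
      then have u: "0 < u" "u < 1" by auto
      note r = tendsto_nat_floor_ratio[OF u(1)] tendsto_nat_floor_ratio_compl[OF u]
      show "(\<lambda>n. F n (nat \<lfloor>(real n + 1) * u\<rfloor>))
        \<longlonglongrightarrow> char Y (t * u) * char Y (t * (1 - u)) * iexp (t * qs_limit_toll u)"
        unfolding F_def using u
        by (intro tendsto_mult lim tendsto_exp tendsto_of_real tendsto_const tendsto_qs_toll
            filterlim_at_top_of_ratio[OF r(1)] filterlim_at_top_of_ratio[OF r(2)] r) auto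
    qed
    have "norm (F n j) \<le> 1" for n j
      unfolding F_def norm_mult using real_distribution.cmod_char_le_1[OF real_distribution_Y_law]
      by (simp add: mult_le_one)
    then show "AE u in unit_uniform. norm (F n (nat \<lfloor>(real n + 1) * u\<rfloor>)) \<le> 1" for n by simp
  qed simp
  moreover have "(CLINT u|unit_uniform. F n (nat \<lfloor>(real n + 1) * u\<rfloor>)) = char (Y_law (Suc n)) t" for n
    unfolding integral_unit_uniform_floor char_Y_law_Suc by (simp only: F_def[abs_def])
  ultimately show "(\<lambda>n. char (Y_law (Suc n)) t) \<longlonglongrightarrow>
      (CLINT u|unit_uniform. char Y (t * u) * char Y (t * (1 - u)) * iexp (t * qs_limit_toll u))"
    by simp
qed

section \<open>Absence of atoms\<close>

definition qs_limit_map :: "real \<Rightarrow> real \<Rightarrow> real \<Rightarrow> real" where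
  "qs_limit_map y z u = u * y + (1 - u) * z + qs_limit_toll u"

text \<open>The derivative in \<open>u\<close> is strictly increasing on the open unit interval.
  Three solutions would, by Rolle, give it two zeros.\<close>

lemma finite_qs_limit_map_eq: "finite {u \<in> {0<..<1}. qs_limit_map y z u = x}"
proof (rule ccontr)
  define S where "S = {u \<in> {0<..<1}. qs_limit_map y z u = x}"
  define g' where "g' u = y - z + 2 * (ln u - ln (1 - u))" for u :: real
  have deriv: "(qs_limit_map y z has_real_derivative g' u) (at u)" if "0 < u" "u < 1" for u
  proof -
    have d: "((\<lambda>u. u * ln u) has_real_derivative ln u + 1) (at u)"
      "((\<lambda>u. (1 - u) * ln (1 - u)) has_real_derivative - ln (1 - u) - 1) (at u)"
      "((\<lambda>u. u * y + (1 - u) * z) has_real_derivative y - z) (at u)"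
      using that by (auto intro!: derivative_eq_intros)
    have "(qs_limit_map y z has_real_derivative
        (y - z) + (0 + 2 * ((ln u + 1) + (- ln (1 - u) - 1)))) (at u)"
      unfolding qs_limit_map_def[abs_def] qs_limit_toll_def
      by (intro DERIV_add DERIV_const DERIV_cmult d)
    then show ?thesis
      by (simp add: g'_def algebra_simps)
  qed
  have rolle: "\<exists>p. a < p \<and> p < b \<and> g' p = 0" if "a \<in> S" "b \<in> S" "a < b" for a b
  proof -
    have "\<exists>p. a < p \<and> p < b \<and> qs_limit_map y z b - qs_limit_map y z a = (b - a) * g' p"
      using that by (intro MVT2) (auto simp: S_def intro!: deriv)
    then show ?thesis using that by (auto simp: S_def)
  qed
  have no3: False if abc: "a \<in> S" "b \<in> S" "c \<in> S" "a < b" "b < c" for a b c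
  proof -
    obtain p q where pq: "a < p" "p < b" "g' p = 0" "b < q" "q < c" "g' q = 0"
      using rolle[OF abc(1,2,4)] rolle[OF abc(2,3,5)] by blast
    moreover have "0 < a" "c < 1" using abc by (auto simp: S_def)
    ultimately have "ln p < ln q" "ln (1 - q) < ln (1 - p)" by simp_all
    with pq show False by (simp add: g'_def)
  qed
  assume "\<not> finite {u \<in> {0<..<1}. qs_limit_map y z u = x}"
  then obtain B where "B \<subseteq> S" "card B = 3"
    using infinite_arbitrarily_large[of S 3] by (auto simp: S_def)
  then obtain a b c where "a \<in> S" "b \<in> S" "c \<in> S" "a \<noteq> b" "b \<noteq> c" "a \<noteq> c"
    by (auto simp: card_3_iff)
  then show False
    using no3 by (metis linorder_neqE)
qed

lemma limit_no_atom:
  assumes Y: "real_distribution Y" and conv: "weak_conv_m Y_law Y"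
  shows "measure Y {x} = 0"
proof -
  interpret Y: real_distribution Y by (rule Y)
  interpret U: prob_space unit_uniform by (rule prob_space_unit_uniform)
  interpret YY: pair_prob_space Y Y ..
  interpret UYY: pair_prob_space unit_uniform "Y \<Otimes>\<^sub>M Y" ..
  define V where "V = (\<lambda>(u, y, z). qs_limit_map y z u)"
  have id [measurable]: "(\<lambda>u. u) \<in> borel_measurable unit_uniform"
    by (rule measurable_unit_uniform) simp
  have V [measurable]: "V \<in> borel_measurable (unit_uniform \<Otimes>\<^sub>M (Y \<Otimes>\<^sub>M Y))"
    unfolding V_def qs_limit_map_def qs_limit_toll_def by measurable
  define M where "M = distr (unit_uniform \<Otimes>\<^sub>M (Y \<Otimes>\<^sub>M Y)) borel V"
  have M: "real_distribution M"
    unfolding M_def by (rule UYY.real_distribution_distr) measurable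
  have "char M t = char Y t" for t
  proof -
    have int: "integrable (Y \<Otimes>\<^sub>M Y) (\<lambda>(y, z). iexp (t * qs_limit_map y z u))" for u
      unfolding qs_limit_map_def by (rule YY.P.integrable_const_bound[where B = 1]) auto
    moreover have "char M t = (CLINT p|(unit_uniform \<Otimes>\<^sub>M (Y \<Otimes>\<^sub>M Y)). iexp (t * V p))"
      unfolding char_def M_def by (subst integral_distr) auto
    moreover have "\<dots> = (CLINT u|unit_uniform. CLINT p|(Y \<Otimes>\<^sub>M Y). iexp (t * V (u, p)))"
      by (rule UYY.integral_fst'[symmetric], rule UYY.P.integrable_const_bound[where B = 1]) auto
    moreover have "(CLINT p|(Y \<Otimes>\<^sub>M Y). iexp (t * V (u, p)))
        = char Y (t * u) * char Y (t * (1 - u)) * iexp (t * qs_limit_toll u)" for u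
    proof -
      have "(CLINT p|(Y \<Otimes>\<^sub>M Y). iexp (t * V (u, p))) = (CLINT y|Y. CLINT z|Y. iexp (t * qs_limit_map y z u))"
        using YY.integral_fst'[OF int] by (simp add: V_def case_prod_unfold)
      moreover have "iexp (t * qs_limit_map y z u)
          = iexp (t * u * y) * (iexp (t * (1 - u) * z) * iexp (t * qs_limit_toll u))" for y z
        by (simp add: exp_add[symmetric] qs_limit_map_def algebra_simps)
      ultimately show ?thesis
        by (simp add: char_def mult.assoc del: of_real_mult of_real_diff)
    qed
    ultimately show ?thesis
      unfolding char_limit_fixed_point[OF Y conv, of t] by (simp only:)
  qed
  \<comment> \<open>Equal characteristic functions identify \<open>Y\<close> with the law of the
    right-hand side of the distributional equation.\<close>
  then have "Y = M"
    by (intro Levy_uniqueness Y M) auto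
  have "emeasure M {x} = emeasure (unit_uniform \<Otimes>\<^sub>M (Y \<Otimes>\<^sub>M Y))
      (V -` {x} \<inter> space (unit_uniform \<Otimes>\<^sub>M (Y \<Otimes>\<^sub>M Y)))"
    unfolding M_def by (rule emeasure_distr) auto
  \<comment> \<open>Fubini with \<open>u\<close> innermost: for fixed \<open>p = (y, z)\<close> the
    fibre is a finite set of \<open>u\<close>, hence a null set.\<close>
  also have "\<dots> = (\<integral>\<^sup>+ p. emeasure unit_uniform ((\<lambda>u. (u, p)) -`
      (V -` {x} \<inter> space (unit_uniform \<Otimes>\<^sub>M (Y \<Otimes>\<^sub>M Y)))) \<partial>(Y \<Otimes>\<^sub>M Y))"
    by (rule UYY.emeasure_pair_measure_alt2) measurable
  also have "\<dots> = 0"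
  proof -
    have "emeasure unit_uniform ((\<lambda>u. (u, p)) -`
      (V -` {x} \<inter> space (unit_uniform \<Otimes>\<^sub>M (Y \<Otimes>\<^sub>M Y)))) = 0" for p
    proof -
      have "(\<lambda>u. (u, p)) -` (V -` {x} \<inter> space (unit_uniform \<Otimes>\<^sub>M (Y \<Otimes>\<^sub>M Y)))
          = {u \<in> {0<..<1}. qs_limit_map (fst p) (snd p) u = x}"
        by (auto simp: V_def space_pair_measure case_prod_unfold)
      then show ?thesis
        using finite_imp_null_set_lborel[OF finite_qs_limit_map_eq[of "fst p" "snd p" x]]
        unfolding unit_uniform_def
        by (subst emeasure_restrict_space) (auto simp: null_sets_def)
    qed
    then show ?thesis by simp
  qed
  finally show ?thesis
    by (simp add: \<open>Y = M\<close> measure_def)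
qed

theorem theorem5p4:
  fixes Y :: "real measure" and n :: nat
  assumes "real_distribution Y"
    and "weak_conv_m Y_law Y"
    and "n \<ge> 1"
  shows "d_KS (Y_law n) Y > 1 / (8 * (real n + 1))"
proof -
  obtain k where k: "pmf (qs n) k > 1 / (4 * (real n + 1))"
    using qs_large_atom[OF assms(3)] .
  \<comment> \<open>The atom of \<open>Y_law n\<close> sits at the normalised value of
    \<open>k\<close>, where the limit law has no mass.\<close>
  have "pmf (qs n) k \<le> 2 * d_KS (Y_law n) Y"
    using jump_le_twice_d_KS[OF real_distribution_Y_law assms(1) limit_no_atom[OF assms(1,2)]]
    unfolding measure_Y_law_singleton[OF assms(3), symmetric] .
  with k have "1 / (4 * (real n + 1)) / 2 < d_KS (Y_law n) Y"
    by (simp only: less_le_trans pos_divide_less_eq zero_less_numeral mult.commute)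
  then show ?thesis by simp
qed

end
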